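(* Let $G$ be an amenable group and let $(X,\mathcal I)$ be an ideal $G$-space. For each partition $X=A_1\cup\dots\cup A_n$ some cell $A_i$ of the partition has $\mathrm{cov}(\Delta_{\mathcal I}(A_i))\le n$; this implies that $\Phi_{(X,\mathcal I)}(n)\le n$ for all $n\in\mathbb N$.
   Context: A $G$-space is a set $X$ with a left action of a group $G$. A Boolean ideal on $X$ is a non-empty family $\mathcal I$ of subsets of $X$ such that $A\cup B\in\mathcal I$ and $A\cap C\in\mathcal I$ for all $A,B\in\mathcal I$, $C\subset X$. It is non-trivial if it is not the family of all subsets of $X$, and $G$-invariant if $gA\in\mathcal I$ for all $A\in\mathcal I$, $g\in G$. An ideal $G$-space is a pair $(X,\mathcal I)$ of a $G$-space $X$ and a non-trivial $G$-invariant Boolean ideal $\mathcal I$ on $X$. For $A\subset X$ put $\Delta_{\mathcal I}(A)=\{x\in G: A\cap xA\notin\mathcal I\}\subset G$. For a non-empty $B\subset G$ put $\mathrm{cov}(B)=\min\{|F|:F\subset G,\ G=FB\}$, and $\mathrm{cov}(\emptyset)=\infty$. For $n\in\mathbb N$, $\Phi_{(X,\mathcal I)}(n)=\sup_{\mathcal C}\min_{C\in\mathcal C}\mathrm{cov}(\Delta_{\mathcal I}(C))$, where $\mathcal C$ runs over all families of subsets of $X$ with $|\mathcal C|\le n$ and $\bigcup\mathcal C=X$. The group $G$ is a discrete group; amenable means that there is a left-invariant finitely additive probability measure on all subsets of $G$ (equivalently, $G$ satisfies the Følner condition). *)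

theory Defs
  imports "HOL-Algebra.Group_Action" "HOL-Analysis.Measure_Space"
begin

definition amenable :: "('a, 'c) monoid_scheme \<Rightarrow> bool" where
  "amenable G \<longleftrightarrow> group G \<and>
     (\<exists>\<mu> :: 'a set \<Rightarrow> real.
        (\<forall>A \<subseteq> carrier G. 0 \<le> \<mu> A) \<and>
        \<mu> (carrier G) = 1 \<and>
        additive (Pow (carrier G)) \<mu> \<and>
        (\<forall>g \<in> carrier G. \<forall>A \<subseteq> carrier G. \<mu> (g <#\<^bsub>G\<^esub> A) = \<mu> A))"

locale boolean_ideal =
  fixes X :: "'b set" and I :: "'b set set"
  assumes ideal_subsets: "I \<subseteq> Pow X"
    and ideal_nonempty: "I \<noteq> {}"
    and ideal_Un: "\<lbrakk> A \<in> I; B \<in> I \<rbrakk> \<Longrightarrow> A \<union> B \<in> I"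
    and ideal_Int: "\<lbrakk> A \<in> I; C \<subseteq> X \<rbrakk> \<Longrightarrow> A \<inter> C \<in> I"

locale ideal_G_space = group_action G X \<phi> + boolean_ideal X I
  for G (structure) and X :: "'b set" and \<phi> and I +
  assumes ideal_nontrivial: "I \<noteq> Pow X"
    and ideal_invariant: "\<lbrakk> A \<in> I; g \<in> carrier G \<rbrakk> \<Longrightarrow> \<phi> g ` A \<in> I"

definition Delta ::
  "('a, 'c) monoid_scheme \<Rightarrow> ('a \<Rightarrow> 'b \<Rightarrow> 'b) \<Rightarrow> 'b set set \<Rightarrow> 'b set \<Rightarrow> 'a set" where
  "Delta G \<phi> I A = {x \<in> carrier G. A \<inter> \<phi> x ` A \<notin> I}"

text \<open>All infinite covering numbers are identified with \<open>\<infinity>\<close>: the infimum of the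
  empty set of extended naturals is \<open>\<infinity>\<close>, so this is the value for every set that
  has no finite covering by left translates, in particular for the empty set.\<close>

definition cov :: "('a, 'c) monoid_scheme \<Rightarrow> 'a set \<Rightarrow> enat" where
  "cov G B = (INF F \<in> {F. F \<subseteq> carrier G \<and> finite F \<and> carrier G = F <#>\<^bsub>G\<^esub> B}. enat (card F))"

definition Phi ::
  "('a, 'c) monoid_scheme \<Rightarrow> 'b set \<Rightarrow> ('a \<Rightarrow> 'b \<Rightarrow> 'b) \<Rightarrow> 'b set set \<Rightarrow> nat \<Rightarrow> enat" where
  "Phi G X \<phi> I n =
     (SUP \<C> \<in> {\<C>. \<C> \<subseteq> Pow X \<and> finite \<C> \<and> card \<C> \<le> n \<and> \<Union>\<C> = X}.
        INF C \<in> \<C>. cov G (Delta G \<phi> I C))"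

end

(* Push the invariant mean of G forward to X along an ultrafilter: if J is a maximal proper ideal
   containing I, then nu A = mu {g. g^-1 A not in J} is a G-invariant mean on X that vanishes on I.
   A set A with cov (Delta A) > n admits n + 1 translates that are pairwise disjoint modulo I,
   so nu A <= 1 / (n + 1). Hence n such sets cannot cover X. *)
theory Submission
  imports Defs
begin

section \<open>Boolean ideals and their prime extensions\<close>

context boolean_ideal
begin

lemma ideal_subset:
  assumes "A \<in> I" "B \<subseteq> A"
  shows "B \<in> I"
proof -
  have "B \<subseteq> X" using assms ideal_subsets by blast
  then have "A \<inter> B \<in> I" using assms(1) ideal_Int by blast
  then show ?thesis using assms(2) by (simp add: Int_absorb1)
qed

lemma empty_in_ideal: "{} \<in> I"
  using ideal_nonempty ideal_subset by blast

lemma top_in_ideal_iff: "X \<in> I \<longleftrightarrow> I = Pow X"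
  using ideal_subsets ideal_subset by blast

text \<open>This family is the ideal generated by \<open>I\<close> and \<open>A\<close>. It may be
  improper; whether \<open>X\<close> belongs to it is the case distinction that exploits maximality
  in \<open>prime_extension\<close>.\<close>

lemma boolean_ideal_adjoin:
  assumes "A \<subseteq> X"
  shows "boolean_ideal X {B. B \<subseteq> X \<and> (\<exists>C\<in>I. B \<subseteq> A \<union> C)}" (is "boolean_ideal X ?K")
proof
  show "?K \<subseteq> Pow X" by blast
  show "?K \<noteq> {}" using assms empty_in_ideal by blast
  fix B C assume "B \<in> ?K"
  then obtain D where D: "B \<subseteq> X" "D \<in> I" "B \<subseteq> A \<union> D" by blast
  show "B \<inter> C \<in> ?K" if "C \<subseteq> X" using D by blast
  assume "C \<in> ?K"
  then obtain E where E: "C \<subseteq> X" "E \<in> I" "C \<subseteq> A \<union> E" by blast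
  have "D \<union> E \<in> I" using D E ideal_Un by blast
  moreover have "B \<union> C \<subseteq> A \<union> (D \<union> E)" using D E by blast
  ultimately show "B \<union> C \<in> ?K" using D E by blast
qed

end

text \<open>Two members of the union already lie in the larger of two comparable ideals, which then
  contains their union. This supplies the upper bounds for Zorn's lemma.\<close>

lemma boolean_ideal_Union_chain:
  assumes "\<C> \<noteq> {}" "\<And>J. J \<in> \<C> \<Longrightarrow> boolean_ideal X J"
    and chain: "\<And>J K. J \<in> \<C> \<Longrightarrow> K \<in> \<C> \<Longrightarrow> J \<subseteq> K \<or> K \<subseteq> J"
  shows "boolean_ideal X (\<Union>\<C>)"
proof
  show "\<Union>\<C> \<subseteq> Pow X" using assms(2) boolean_ideal.ideal_subsets by blast
  show "\<Union>\<C> \<noteq> {}" using assms(1,2) boolean_ideal.ideal_nonempty by fastforce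
  fix A B assume "A \<in> \<Union>\<C>"
  then obtain J where J: "J \<in> \<C>" "A \<in> J" by blast
  show "A \<inter> B \<in> \<Union>\<C>" if "B \<subseteq> X"
    using J that assms(2) boolean_ideal.ideal_Int by blast
  assume "B \<in> \<Union>\<C>"
  then obtain K where K: "K \<in> \<C>" "B \<in> K" by blast
  then obtain L where "L \<in> \<C>" "A \<in> L" "B \<in> L" using J chain by blast
  then show "A \<union> B \<in> \<Union>\<C>" using assms(2) boolean_ideal.ideal_Un by blast
qed

text \<open>The ultrafilter lemma in its dual form: an ideal that is maximal among the proper ones
  containing \<open>I\<close> decides every subset of \<open>X\<close>.\<close>

lemma (in boolean_ideal) prime_extension:
  assumes "X \<notin> I"
  obtains J where "boolean_ideal X J" "I \<subseteq> J" "X \<notin> J" "\<And>A. A \<subseteq> X \<Longrightarrow> A \<in> J \<or> X - A \<in> J"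
proof -
  let ?P = "{J. boolean_ideal X J \<and> I \<subseteq> J \<and> X \<notin> J}"
  have "\<exists>J\<in>?P. \<forall>K\<in>?P. J \<subseteq> K \<longrightarrow> K = J"
  proof (rule subset_Zorn_nonempty)
    show "?P \<noteq> {}" using assms boolean_ideal_axioms by blast
    fix \<C> assume ne: "\<C> \<noteq> {}" and "subset.chain ?P \<C>"
    then have sub: "\<C> \<subseteq> ?P" and chain: "\<And>J K. J \<in> \<C> \<Longrightarrow> K \<in> \<C> \<Longrightarrow> J \<subseteq> K \<or> K \<subseteq> J"
      by (auto simp: subset_chain_def)
    have "boolean_ideal X (\<Union>\<C>)"
      using ne sub chain by (intro boolean_ideal_Union_chain) auto
    then show "\<Union>\<C> \<in> ?P" using ne sub by blast
  qed
  then obtain J where "J \<in> ?P" and max: "\<forall>K\<in>?P. J \<subseteq> K \<longrightarrow> K = J" ..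
  then have J: "boolean_ideal X J" "I \<subseteq> J" "X \<notin> J" by auto
  interpret J: boolean_ideal X J by fact
  have "A \<in> J \<or> X - A \<in> J" if A: "A \<subseteq> X" for A
  proof -
    let ?K = "{B. B \<subseteq> X \<and> (\<exists>C\<in>J. B \<subseteq> A \<union> C)}"
    have sub: "J \<subseteq> ?K" using J.ideal_subsets by blast
    have "A \<in> ?K" using A J.empty_in_ideal by blast
    \<comment> \<open>If adjoining \<open>A\<close> to \<open>J\<close> produces \<open>X\<close>,
      then a member of \<open>J\<close> covers the complement of \<open>A\<close>. Otherwise the
      enlarged ideal is proper, so by maximality it equals \<open>J\<close> and \<open>A\<close> is
      in \<open>J\<close>.\<close>
    show ?thesis
    proof (cases "X \<in> ?K")
      case True
      then obtain C where "C \<in> J" "X - A \<subseteq> C" by blast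
      then show ?thesis using J.ideal_subset by blast
    next
      case False
      then have "?K \<in> ?P"
        using sub J(2) J.boolean_ideal_adjoin[OF A] by blast
      then have "?K = J" using max sub by blast
      then show ?thesis using \<open>A \<in> ?K\<close> by blast
    qed
  qed
  then show ?thesis using J that by blast
qed

section \<open>Finitely additive means vanishing on an ideal\<close>

locale null_mean = boolean_ideal X I for X :: "'b set" and I +
  fixes \<nu> :: "'b set \<Rightarrow> real"
  assumes nonneg: "A \<subseteq> X \<Longrightarrow> 0 \<le> \<nu> A"
    and total: "\<nu> X = 1"
    and additive: "additive (Pow X) \<nu>"
    and null: "A \<in> I \<Longrightarrow> \<nu> A = 0"
begin

lemma mean_diff:
  assumes "A \<subseteq> X" "B \<subseteq> A"
  shows "\<nu> (A - B) = \<nu> A - \<nu> B"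
proof -
  have "\<nu> ((A - B) \<union> B) = \<nu> (A - B) + \<nu> B"
    using assms by (intro additiveD[OF additive]) auto
  then show ?thesis using assms(2) by (simp add: Un_absorb2)
qed

lemma mean_mono:
  assumes "A \<subseteq> B" "B \<subseteq> X"
  shows "\<nu> A \<le> \<nu> B"
  using mean_diff[OF assms(2,1)] nonneg[of "B - A"] assms by auto

lemma mean_Un_Int:
  assumes "A \<subseteq> X" "B \<subseteq> X"
  shows "\<nu> (A \<union> B) + \<nu> (A \<inter> B) = \<nu> A + \<nu> B"
proof -
  have "\<nu> (A \<union> (B - A \<inter> B)) = \<nu> A + \<nu> (B - A \<inter> B)"
    using assms by (intro additiveD[OF additive]) auto
  moreover have "\<nu> (B - A \<inter> B) = \<nu> B - \<nu> (A \<inter> B)"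
    using assms by (intro mean_diff) auto
  moreover have "A \<union> (B - A \<inter> B) = A \<union> B" by blast
  ultimately show ?thesis by simp
qed

lemma mean_UN_le:
  assumes "finite K" "\<And>k. k \<in> K \<Longrightarrow> A k \<subseteq> X"
  shows "\<nu> (\<Union>k\<in>K. A k) \<le> (\<Sum>k\<in>K. \<nu> (A k))"
  using assms
proof (induction K)
  case empty
  then show ?case using null empty_in_ideal by simp
next
  case (insert k K)
  then have "\<nu> (A k \<union> (\<Union>k\<in>K. A k)) + \<nu> (A k \<inter> (\<Union>k\<in>K. A k)) = \<nu> (A k) + \<nu> (\<Union>k\<in>K. A k)"
    by (intro mean_Un_Int) auto
  moreover have "0 \<le> \<nu> (A k \<inter> (\<Union>k\<in>K. A k))"
    using insert.prems by (intro nonneg) auto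
  ultimately show ?case using insert by force
qed

text \<open>In the modular law of \<open>mean_Un_Int\<close> the intersection term vanishes, because
  the new set meets the union of the earlier ones in a finite union of members of
  \<open>I\<close>.\<close>

lemma mean_UN_almost_disjoint:
  fixes S :: "nat \<Rightarrow> 'b set"
  assumes "\<And>k. k < m \<Longrightarrow> S k \<subseteq> X" "\<And>j k. j < k \<Longrightarrow> k < m \<Longrightarrow> S j \<inter> S k \<in> I"
  shows "\<nu> (\<Union>k<m. S k) = (\<Sum>k<m. \<nu> (S k))"
  using assms
proof (induction m)
  case 0
  then show ?case using null empty_in_ideal by simp
next
  case (Suc m)
  have disj: "S j \<inter> S m \<in> I" if "j < m" for j using Suc.prems(2) that by blast
  \<comment> \<open>The induction runs over initial segments up to \<open>m\<close>, since the
    overlaps with \<open>S m\<close> are known to be in \<open>I\<close> only for indices below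
    \<open>m\<close>.\<close>
  have "(\<Union>j<l. S j \<inter> S m) \<in> I" if "l \<le> m" for l
    using that
  proof (induction l)
    case 0
    then show ?case using empty_in_ideal by simp
  next
    case (Suc l)
    then show ?case using disj by (simp add: lessThan_Suc ideal_Un)
  qed
  then have "\<nu> (S m \<inter> (\<Union>k<m. S k)) = 0"
    using null[of "\<Union>j<m. S j \<inter> S m"] by (simp add: Int_commute UN_simps)
  moreover have "\<nu> (S m \<union> (\<Union>k<m. S k)) + \<nu> (S m \<inter> (\<Union>k<m. S k)) = \<nu> (S m) + \<nu> (\<Union>k<m. S k)"
    using Suc.prems(1) by (intro mean_Un_Int) (auto simp: less_Suc_eq)
  ultimately show ?case
    using Suc by (simp add: lessThan_Suc)
qed

end

section \<open>Translates of sets and the induced invariant mean\<close>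

lemma (in group_action) image_mult:
  assumes "A \<subseteq> E" "g \<in> carrier G" "h \<in> carrier G"
  shows "\<phi> (g \<otimes> h) ` A = \<phi> g ` \<phi> h ` A"
  using assms composition_rule by (force simp: image_image intro!: image_cong)

lemma (in group_action) image_subset:
  assumes "A \<subseteq> E" "g \<in> carrier G"
  shows "\<phi> g ` A \<subseteq> E"
  using assms surj_prop by blast

text \<open>The map \<open>W\<close> sends subsets of \<open>X\<close> to subsets of the group and
  respects unions, disjointness and translation, so composing \<open>\<mu>\<close> with it yields a
  mean on \<open>X\<close> with the same invariance.\<close>

lemma (in ideal_G_space) invariant_null_mean:
  assumes "amenable G"
  obtains \<nu> where "null_mean X I \<nu>"
    "\<And>g A. g \<in> carrier G \<Longrightarrow> A \<subseteq> X \<Longrightarrow> \<nu> (\<phi> g ` A) = \<nu> A"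
proof -
  interpret group G using assms by (simp add: amenable_def)
  obtain \<mu> :: "'a set \<Rightarrow> real" where
    \<mu>: "\<And>A. A \<subseteq> carrier G \<Longrightarrow> 0 \<le> \<mu> A" "\<mu> (carrier G) = 1" "additive (Pow (carrier G)) \<mu>"
      "\<And>g A. g \<in> carrier G \<Longrightarrow> A \<subseteq> carrier G \<Longrightarrow> \<mu> (g <# A) = \<mu> A"
    using assms unfolding amenable_def by metis
  have "X \<notin> I" using ideal_nontrivial top_in_ideal_iff by blast
  then obtain J where J: "boolean_ideal X J" "I \<subseteq> J" "X \<notin> J"
    and prime: "\<And>A. A \<subseteq> X \<Longrightarrow> A \<in> J \<or> X - A \<in> J"
    using prime_extension by metis
  interpret J: boolean_ideal X J by fact
  \<comment> \<open>The inverse makes \<open>W\<close> equivariant for left translation: translating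
    \<open>A\<close> by \<open>g\<close> translates \<open>W A\<close> by \<open>g\<close> on the
    left.\<close>
  define W where "W A = {g \<in> carrier G. \<phi> (inv g) ` A \<notin> J}" for A
  have W_sub: "W A \<subseteq> carrier G" for A by (auto simp: W_def)
  \<comment> \<open>Invariance of \<open>I\<close> enters here: every translate of a member of
    \<open>I\<close> is again in \<open>I\<close>, hence in \<open>J\<close>.\<close>
  have W_null: "W A = {}" if "A \<in> I" for A
    using that J(2) ideal_invariant by (auto simp: W_def)
  have \<mu>_empty: "\<mu> {} = 0" using additiveD[OF \<mu>(3), of "{}" "{}"] by simp
  have W_Un: "W (A \<union> B) = W A \<union> W B" if "A \<subseteq> X" "B \<subseteq> X" for A B
    by (auto simp: W_def image_Un intro: J.ideal_Un J.ideal_subset)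
  \<comment> \<open>Primeness of \<open>J\<close> enters here: if one of two disjoint images is
    outside \<open>J\<close>, then its complement is in \<open>J\<close> and contains the
    other.\<close>
  have W_disj: "W A \<inter> W B = {}" if AB: "A \<subseteq> X" "B \<subseteq> X" "A \<inter> B = {}" for A B
  proof -
    have "\<phi> h ` A \<in> J \<or> \<phi> h ` B \<in> J" if h: "h \<in> carrier G" for h
    proof -
      have "\<phi> h ` A \<inter> \<phi> h ` B = {}"
        using inj_on_image_Int[OF inj_prop[OF h] AB(1,2)] AB(3) by simp
      then have "\<phi> h ` B \<subseteq> X - \<phi> h ` A" using image_subset[OF AB(2) h] by blast
      then show ?thesis
        using prime[OF image_subset[OF AB(1) h]] J.ideal_subset by blast
    qed
    then show ?thesis by (auto simp: W_def)
  qed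
  have W_shift: "W (\<phi> g ` A) = g <# W A" if g: "g \<in> carrier G" and A: "A \<subseteq> X" for g A
  proof -
    \<comment> \<open>Since \<open>inv h \<otimes> g\<close> is the inverse of
      \<open>inv g \<otimes> h\<close>, the element \<open>h\<close> lies in the set for the
      translate exactly when \<open>inv g \<otimes> h\<close> lies in \<open>W A\<close>.\<close>
    have shift: "\<phi> (inv h) ` \<phi> g ` A = \<phi> (inv (inv g \<otimes> h)) ` A" if "h \<in> carrier G" for h
      using that g A image_mult[of A "inv h" g] by (simp add: inv_mult_group)
    show ?thesis
    proof (intro equalityI subsetI)
      fix h assume h: "h \<in> W (\<phi> g ` A)"
      then have hG: "h \<in> carrier G" using W_sub by blast
      then have "inv g \<otimes> h \<in> W A" using h g shift by (simp add: W_def)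
      moreover have "h = g \<otimes> (inv g \<otimes> h)" using g hG by (simp add: m_assoc[symmetric])
      ultimately show "h \<in> g <# W A" unfolding l_coset_def by blast
    next
      fix h assume "h \<in> g <# W A"
      then obtain k where k: "k \<in> W A" "h = g \<otimes> k" unfolding l_coset_def by blast
      then have "k \<in> carrier G" using W_sub by blast
      moreover from this have "inv g \<otimes> h = k" using k g by (simp add: m_assoc[symmetric])
      ultimately show "h \<in> W (\<phi> g ` A)" using k g shift by (simp add: W_def)
    qed
  qed
  have "null_mean X I (\<lambda>A. \<mu> (W A))"
  proof unfold_locales
    show "0 \<le> \<mu> (W A)" for A using \<mu>(1) W_sub by blast
    have "W X = carrier G" using surj_prop J(3) by (auto simp: W_def)
    then show "\<mu> (W X) = 1" using \<mu>(2) by simp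
    show "additive (Pow X) (\<lambda>A. \<mu> (W A))"
      unfolding additive_def using W_Un W_disj W_sub additiveD[OF \<mu>(3)] by auto
    show "\<mu> (W A) = 0" if "A \<in> I" for A using W_null[OF that] \<mu>_empty by simp
  qed
  moreover have "\<mu> (W (\<phi> g ` A)) = \<mu> (W A)" if "g \<in> carrier G" "A \<subseteq> X" for g A
    using that W_shift \<mu>(4) W_sub by simp
  ultimately show ?thesis by (rule that)
qed

section \<open>Large covering numbers and translates disjoint modulo the ideal\<close>

lemma (in group) separated_sequence:
  assumes B: "B \<subseteq> carrier G" and large: "\<not> cov G B \<le> enat n" and "m \<le> Suc n"
  shows "\<exists>x. (\<forall>k<m. x k \<in> carrier G) \<and> (\<forall>k<m. \<forall>j<k. inv (x j) \<otimes> x k \<notin> B)"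
  using \<open>m \<le> Suc n\<close>
proof (induction m)
  case 0
  then show ?case by simp
next
  case (Suc m)
  then obtain x where x: "\<forall>k<m. x k \<in> carrier G" "\<forall>k<m. \<forall>j<k. inv (x j) \<otimes> x k \<notin> B"
    by auto
  let ?F = "x ` {..<m}"
  \<comment> \<open>Greedy choice: when the point with index \<open>m\<close> is chosen, only
    \<open>m \<le> n\<close> points precede it, so the left translates of \<open>B\<close> by them
    cannot cover the group. An uncovered \<open>g\<close> is separated from each of them and extends
    the sequence; this works up to \<open>n + 1\<close> points.\<close>
  have "card ?F \<le> n" using card_image_le[of "{..<m}" x] Suc.prems by simp
  have F: "?F \<subseteq> carrier G" using x(1) by blast
  have "carrier G \<noteq> ?F <#> B"
  proof
    assume "carrier G = ?F <#> B"
    then have "cov G B \<le> enat (card ?F)"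
      unfolding cov_def using F by (intro INF_lower) simp
    also have "\<dots> \<le> enat n" using \<open>card ?F \<le> n\<close> by simp
    finally show False using large by contradiction
  qed
  moreover have "?F <#> B \<subseteq> carrier G" using F B by (rule set_mult_closed)
  ultimately obtain g where g: "g \<in> carrier G" "g \<notin> ?F <#> B" by blast
  have new: "inv (x j) \<otimes> g \<notin> B" if "j < m" for j
  proof
    assume "inv (x j) \<otimes> g \<in> B"
    moreover have "g = x j \<otimes> (inv (x j) \<otimes> g)"
      using that x(1) g(1) by (simp add: m_assoc[symmetric])
    ultimately show False using g(2) that unfolding set_mult_def by blast
  qed
  show ?case
    using x g(1) new by (intro exI[of _ "x(m := g)"]) (auto simp: less_Suc_eq)
qed

text \<open>A sequence of \<open>n + 1\<close> points separated by \<open>Delta G \<phi> I A\<close>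
  gives \<open>n + 1\<close> translates of \<open>A\<close> that are disjoint modulo
  \<open>I\<close>. They have equal mean and all fit into \<open>X\<close>, which has mean
  1.\<close>

lemma (in ideal_G_space) mean_le_if_cov_large:
  assumes "null_mean X I \<nu>"
    and inv: "\<And>g A. g \<in> carrier G \<Longrightarrow> A \<subseteq> X \<Longrightarrow> \<nu> (\<phi> g ` A) = \<nu> A"
    and A: "A \<subseteq> X" and large: "\<not> cov G (Delta G \<phi> I A) \<le> enat n"
  shows "real (Suc n) * \<nu> A \<le> 1"
proof -
  interpret null_mean X I \<nu> by fact
  interpret group G using group_hom group_hom.axioms(1) by auto
  have "Delta G \<phi> I A \<subseteq> carrier G" by (auto simp: Delta_def)
  from separated_sequence[OF this large order_refl] obtain x where
    x: "\<And>k. k < Suc n \<Longrightarrow> x k \<in> carrier G"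
      "\<And>j k. j < k \<Longrightarrow> k < Suc n \<Longrightarrow> inv (x j) \<otimes> x k \<notin> Delta G \<phi> I A"
    by blast
  let ?S = "\<lambda>k. \<phi> (x k) ` A"
  have sub: "?S k \<subseteq> X" if "k < Suc n" for k
    using image_subset[OF A x(1)[OF that]] .
  have "?S j \<inter> ?S k \<in> I" if jk: "j < k" "k < Suc n" for j k
  proof -
    have G: "x j \<in> carrier G" "x k \<in> carrier G" using x(1) jk by auto
    let ?g = "inv (x j) \<otimes> x k"
    have g: "?g \<in> carrier G" using G by simp
    then have "A \<inter> \<phi> ?g ` A \<in> I" using x(2)[OF jk] by (simp add: Delta_def)
    \<comment> \<open>Moving the overlap by \<open>x j\<close> turns it into the overlap of the
      translates by \<open>x j\<close> and \<open>x k\<close>, as \<open>x j \<otimes> ?g\<close> is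
      \<open>x k\<close>.\<close>
    then have "\<phi> (x j) ` (A \<inter> \<phi> ?g ` A) \<in> I" using G by (intro ideal_invariant)
    also have "\<phi> (x j) ` (A \<inter> \<phi> ?g ` A) = ?S j \<inter> \<phi> (x j) ` \<phi> ?g ` A"
      using inj_on_image_Int[OF inj_prop[OF G(1)] A image_subset[OF A g]] .
    also have "\<phi> (x j) ` \<phi> ?g ` A = ?S k"
      using image_mult[OF A G(1) g] G by (simp add: m_assoc[symmetric])
    finally show ?thesis .
  qed
  then have "\<nu> (\<Union>k<Suc n. ?S k) = (\<Sum>k<Suc n. \<nu> (?S k))"
    using sub by (intro mean_UN_almost_disjoint)
  also have "\<dots> = (\<Sum>k<Suc n. \<nu> A)"
    using x(1) A inv by (intro sum.cong) auto
  finally have "real (Suc n) * \<nu> A = \<nu> (\<Union>k<Suc n. ?S k)" by simp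
  also have "\<dots> \<le> \<nu> X" using sub by (intro mean_mono) auto
  finally show ?thesis using total by simp
qed

text \<open>Otherwise each set has mean at most \<open>1 / (card K + 1)\<close>, too little for
  \<open>card K\<close> of them to reach the total mean 1. Indexing the cover by an arbitrary finite
  set serves both numbered partitions and families of sets.\<close>

lemma (in ideal_G_space) cover_has_cell_with_small_cov:
  assumes "amenable G" "finite K" "(\<Union>k\<in>K. A k) = X"
  shows "\<exists>k\<in>K. cov G (Delta G \<phi> I (A k)) \<le> enat (card K)"
proof (rule ccontr)
  assume neg: "\<not> ?thesis"
  obtain \<nu> where \<nu>: "null_mean X I \<nu>"
    "\<And>g A. g \<in> carrier G \<Longrightarrow> A \<subseteq> X \<Longrightarrow> \<nu> (\<phi> g ` A) = \<nu> A"
    using invariant_null_mean[OF assms(1)] by metis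
  interpret null_mean X I \<nu> by fact
  let ?n = "card K"
  have sub: "A k \<subseteq> X" if "k \<in> K" for k using assms(3) that by blast
  have small: "real (Suc ?n) * \<nu> (A k) \<le> 1" if "k \<in> K" for k
    using mean_le_if_cov_large[OF \<nu> sub[OF that]] neg that by blast
  have "real (Suc ?n) = real (Suc ?n) * \<nu> (\<Union>k\<in>K. A k)"
    using assms(3) total by simp
  also have "\<dots> \<le> real (Suc ?n) * (\<Sum>k\<in>K. \<nu> (A k))"
    using mean_UN_le[OF assms(2) sub] by (intro mult_left_mono) auto
  also have "\<dots> = (\<Sum>k\<in>K. real (Suc ?n) * \<nu> (A k))" by (rule sum_distrib_left)
  \<comment> \<open>The last sum is \<open>card K\<close>, so the chain reads
    \<open>card K + 1 \<le> card K\<close>; this is absurd for empty \<open>K\<close> as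
    well.\<close>
  also have "\<dots> \<le> (\<Sum>k\<in>K. 1)"
    using small by (rule sum_mono)
  finally show False by simp
qed

theorem theorem4p3:
  fixes G :: "('a, 'c) monoid_scheme" and X :: "'b set"
    and \<phi> :: "'a \<Rightarrow> 'b \<Rightarrow> 'b" and I :: "'b set set"
  assumes "amenable G"
    and "ideal_G_space G X \<phi> I"
  shows "(\<forall>(n::nat) (A :: nat \<Rightarrow> 'b set).
            disjoint_family_on A {1..n} \<and> (\<Union>i\<in>{1..n}. A i) = X \<longrightarrow>
            (\<exists>i\<in>{1..n}. cov G (Delta G \<phi> I (A i)) \<le> enat n))
       \<and> (\<forall>n::nat. Phi G X \<phi> I n \<le> enat n)"
proof -
  interpret ideal_G_space G X \<phi> I by fact
  have "\<exists>i\<in>{1..n}. cov G (Delta G \<phi> I (A i)) \<le> enat n" if "(\<Union>i\<in>{1..n}. A i) = X"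
    for n and A :: "nat \<Rightarrow> 'b set"
    using cover_has_cell_with_small_cov[OF assms(1) finite_atLeastAtMost that]
    by (simp only: card_atLeastAtMost diff_Suc_1)
  moreover have "Phi G X \<phi> I n \<le> enat n" for n
    unfolding Phi_def
  proof (rule SUP_least)
    fix \<C> assume "\<C> \<in> {\<C>. \<C> \<subseteq> Pow X \<and> finite \<C> \<and> card \<C> \<le> n \<and> \<Union>\<C> = X}"
    \<comment> \<open>The family is indexed by itself to match the covering lemma, whose bound
      \<open>card \<C>\<close> is then weakened to \<open>n\<close>.\<close>
    then have \<C>: "finite \<C>" "card \<C> \<le> n" "(\<Union>C\<in>\<C>. C) = X" by auto
    obtain C where C: "C \<in> \<C>" "cov G (Delta G \<phi> I C) \<le> enat (card \<C>)"
      using cover_has_cell_with_small_cov[OF assms(1) \<C>(1,3)] by blast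
    have "(INF C\<in>\<C>. cov G (Delta G \<phi> I C)) \<le> enat (card \<C>)"
      using C by (rule INF_lower2)
    also have "\<dots> \<le> enat n" using \<C>(2) by simp
    finally show "(INF C\<in>\<C>. cov G (Delta G \<phi> I C)) \<le> enat n" .
  qed
  ultimately show ?thesis by (intro conjI allI impI) (elim conjE)
qed

end
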